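(* Let $(\mu,k)$ be a spherical profile, i.e. $\sum_i\mu_i(i-2)=k-4$, with $k\ge2$. Then there exists a path-like square-tiled surface with profile $(\mu,k)$.
   Context: A square-tiled surface on $[n]$ is a triple $\tau=(\tau_R,\tau_G,\tau_B)$ of involutions of $[n]$ (fixed points allowed) with $\langle\tau_R,\tau_G,\tau_B\rangle$ transitive on $[n]$. Its profile is $(\mu,k)$ where $\mu=[1^{\mu_1},2^{\mu_2},\dots]$ is the cycle type of $\tau_R\tau_G\tau_B$ and $k$ is the total number of fixed points of $\tau_R,\tau_G,\tau_B$. The dual cubic graph $S^*(\tau)$ has vertex set $[n]$, a colour-$c$ edge for each transposition of $\tau_c$ and a colour-$c$ half-edge at each fixed point of $\tau_c$. A $\{G,B\}$-component is an orbit of $\langle\tau_G,\tau_B\rangle$; in $S^*(\tau)$ it is a path or a cycle. $\tau$ is path-like if it has exactly one $\{G,B\}$-component and this component is a path. *)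

theory Defs
  imports
    "HOL-Algebra.Sym_Groups"
    "HOL-Combinatorics.Orbits"
    "HOL-Library.Multiset"
begin

datatype colour = Red | Green | Blue

text \<open>A triple of permutations is encoded as a colour-indexed family, and \<open>[n]\<close> is \<open>{1..n}\<close>.
  Permutations in the sense of \<open>permutes\<close> are the identity outside \<open>{1..n}\<close>.\<close>

type_synonym perm_triple = "colour \<Rightarrow> nat \<Rightarrow> nat"

definition colour_group :: "nat \<Rightarrow> perm_triple \<Rightarrow> colour set \<Rightarrow> (nat \<Rightarrow> nat) set" where
  "colour_group n \<tau> C = generate (sym_group n) (\<tau> ` C)"

definition square_tiled_surface :: "nat \<Rightarrow> perm_triple \<Rightarrow> bool" where
  "square_tiled_surface n \<tau> \<longleftrightarrow>
     (\<forall>c. \<tau> c permutes {1..n} \<and> \<tau> c \<circ> \<tau> c = id) \<and>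
     (\<forall>x\<in>{1..n}. \<forall>y\<in>{1..n}. \<exists>g\<in>colour_group n \<tau> {Red, Green, Blue}. g x = y)"

text \<open>Here \<open>orbit p x\<close> is the cycle of \<open>p\<close> through \<open>x\<close>; it is \<open>{x}\<close> for a fixed point, so fixed
  points contribute parts equal to \<open>1\<close>.\<close>

definition cycle_type :: "nat \<Rightarrow> (nat \<Rightarrow> nat) \<Rightarrow> nat multiset" where
  "cycle_type n p = image_mset card (mset_set (orbit p ` {1..n}))"

definition num_fixed_points :: "nat \<Rightarrow> perm_triple \<Rightarrow> nat" where
  "num_fixed_points n \<tau> = (\<Sum>c\<in>{Red, Green, Blue}. card {x\<in>{1..n}. \<tau> c x = x})"

definition profile :: "nat \<Rightarrow> perm_triple \<Rightarrow> nat multiset \<times> nat" where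
  "profile n \<tau> = (cycle_type n (\<tau> Red \<circ> \<tau> Green \<circ> \<tau> Blue), num_fixed_points n \<tau>)"

text \<open>The multiplicity \<open>\<mu>\<^sub>i\<close> of the part \<open>i\<close> is \<open>count \<mu> i\<close>.\<close>

definition spherical :: "nat multiset \<Rightarrow> nat \<Rightarrow> bool" where
  "spherical \<mu> k \<longleftrightarrow> (\<Sum>i\<in>set_mset \<mu>. int (count \<mu> i) * (int i - 2)) = int k - 4"

text \<open>The dual cubic graph is a multigraph: edges carry their colour, so two transpositions
  \<open>(x y)\<close> of different colours give two parallel edges.\<close>

definition dual_edges :: "nat \<Rightarrow> perm_triple \<Rightarrow> (colour \<times> nat set) set" where
  "dual_edges n \<tau> = {(c, {x, \<tau> c x}) | c x. x \<in> {1..n} \<and> \<tau> c x \<noteq> x}"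

definition dual_half_edges :: "nat \<Rightarrow> perm_triple \<Rightarrow> (colour \<times> nat) set" where
  "dual_half_edges n \<tau> = {(c, x). x \<in> {1..n} \<and> \<tau> c x = x}"

definition GB_components :: "nat \<Rightarrow> perm_triple \<Rightarrow> nat set set" where
  "GB_components n \<tau> = {{g x | g. g \<in> colour_group n \<tau> {Green, Blue}} | x. x \<in> {1..n}}"

text \<open>A component is a path when its vertices can be listed without repetition as \<open>vs\<close> so that its
  Green and Blue edges are exactly one edge between each two consecutive vertices, and its Green and
  Blue half-edges are one at each end. The list \<open>cs\<close> gives the colours met along the path: the
  first half-edge, the edges, the last half-edge. If \<open>vs\<close> is a single vertex, both half-edges are
  at that vertex.\<close>

definition is_path :: "nat \<Rightarrow> perm_triple \<Rightarrow> nat set \<Rightarrow> bool" where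
  "is_path n \<tau> C \<longleftrightarrow>
     (\<exists>vs cs. vs \<noteq> [] \<and> distinct vs \<and> set vs = C \<and> length cs = Suc (length vs) \<and>
        {(c, e) \<in> dual_edges n \<tau>. c \<in> {Green, Blue} \<and> e \<subseteq> C} =
          {(cs ! Suc i, {vs ! i, vs ! Suc i}) | i. Suc i < length vs} \<and>
        {(c, x) \<in> dual_half_edges n \<tau>. c \<in> {Green, Blue} \<and> x \<in> C} =
          {(hd cs, hd vs), (last cs, last vs)})"

definition path_like :: "nat \<Rightarrow> perm_triple \<Rightarrow> bool" where
  "path_like n \<tau> \<longleftrightarrow> (\<exists>C. GB_components n \<tau> = {C} \<and> is_path n \<tau> C)"

end

theory Submission
  imports Defs
begin

text \<open>Along a path the product \<open>\<tau>\<^sub>G \<tau>\<^sub>B\<close> is an \<open>n\<close>-cycle, and conversely every \<open>n\<close>-cycle \<open>c\<close> arises in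
  this way. So it suffices to find an \<open>n\<close>-cycle \<open>c\<close> and an involution \<open>r\<close> with \<open>f = k - 2\<close> fixed
  points such that \<open>r c\<close> has cycle type \<open>\<mu>\<close>; sphericity reads \<open>n + 2 = 2 \<ell> + f\<close>, where \<open>\<ell>\<close> is the
  number of parts. This goes by induction on \<open>n\<close>, adding a new point \<open>y = n + 1\<close>:

  \<^item> replacing \<open>c\<close> by \<open>c (x y)\<close> lengthens the cycle of \<open>r c\<close> through \<open>x\<close> by one and makes \<open>y\<close> a new
    fixed point of \<open>r\<close>;
  \<^item> if \<open>r x = x\<close>, replacing \<open>c\<close> by \<open>c (x y)\<close> and \<open>r\<close> by \<open>(x y) r\<close> conjugates \<open>r c\<close> by \<open>(x y)\<close>, which
    adds a part \<open>1\<close>, and costs the fixed point \<open>x\<close>.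

  If \<open>f = 0\<close> then \<open>\<mu>\<close> has a part \<open>1\<close> and the second step applies; if \<open>f > 0\<close> then the first step
  applies unless all parts are \<open>1\<close>, which forces \<open>\<mu> = [1]\<close>.\<close>

section \<open>Cycle types under transpositions and conjugation\<close>

text \<open>The cycle is traversed as before, except for the detour from \<open>x\<close> to
  \<open>y\<close> to \<open>q x\<close>.\<close>

lemma cyclic_on_insert:
  assumes "cyclic_on q S" and "x \<in> S" and "y \<notin> S" and "q y = y"
  shows "cyclic_on (q \<circ> transpose x y) (insert y S)"
proof (rule cyclic_on_singleI)
  let ?q = "q \<circ> transpose x y"
  have S: "S = orbit q x"
    using assms orbit_cyclic_eq3 by metis
  have vals: "?q x = y" "?q y = q x" "\<And>z. z \<noteq> x \<Longrightarrow> z \<noteq> y \<Longrightarrow> ?q z = q z"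
    using assms by (auto simp: transpose_def)
  have y: "y \<in> orbit ?q x"
    using orbit.base[of ?q x] vals(1) by simp
  have qx: "q x \<in> orbit ?q x"
    using orbit.step[OF y] vals(2) by simp
  have "z \<in> orbit ?q x" if "z \<in> orbit q x" for z
    using that
  proof induction
    case (step z)
    then show ?case
      using orbit.step[OF step.IH] vals(3)[of z] qx S assms(3) by metis
  qed (rule qx)
  moreover have "z \<in> insert y S" if "z \<in> orbit ?q x" for z
    using that
  proof induction
    case (step z)
    then show ?case
      using vals cyclic_on_inI[OF assms(1)] assms(2) by (metis insert_iff)
  qed (simp only: vals insertI1)
  ultimately show "insert y S = orbit ?q x"
    using y S by blast
qed (use assms in simp)

lemma card_orbit_mem_cycle_type:
  assumes "m \<in># cycle_type n q"
  obtains x where "x \<in> {1..n}" and "card (orbit q x) = m"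
  using assms by (auto simp: cycle_type_def)

lemma orbit_permutes_atLeastAtMost:
  fixes q :: "nat \<Rightarrow> nat"
  assumes "q permutes {1..n}"
  shows "x \<in> orbit q x" and "cyclic_on q (orbit q x)"
    and "x \<in> {1..n} \<Longrightarrow> orbit q x \<subseteq> {1..n}"
  using assms permutation_self_in_orbit[of q x] cyclic_on_orbit[of q _ x]
    permutes_orbit_subset[of q _ x]
  by (auto simp: permutation_permutes)

text \<open>Only the cycle through \<open>x\<close> changes: the new point is inserted right after
  \<open>x\<close>, and \<open>q\<close> is unaltered on all other orbits. Adding the old length on
  the left avoids multiset subtraction.\<close>

lemma cycle_type_enlarge:
  assumes q: "q permutes {1..n}" and x: "x \<in> {1..n}"
  shows "add_mset (card (orbit q x)) (cycle_type (Suc n) (q \<circ> transpose x (Suc n))) =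
    add_mset (Suc (card (orbit q x))) (cycle_type n q)"
proof -
  let ?y = "Suc n" and ?q = "q \<circ> transpose x (Suc n)" and ?O = "orbit q x"
  let ?A = "orbit q ` {1..n}"
  have O: "?O \<subseteq> {1..n}" "finite ?O"
    using orbit_permutes_atLeastAtMost(3)[OF q x] finite_subset by auto
  have cyc: "cyclic_on ?q (insert ?y ?O)"
  proof (rule cyclic_on_insert)
    show "?y \<notin> ?O"
      using O(1) by auto
    show "q ?y = ?y"
      using q by (simp add: permutes_def)
  qed (use orbit_permutes_atLeastAtMost[OF q] in auto)
  have old: "orbit ?q z = orbit q z" if z: "z \<in> {1..n}" "z \<notin> ?O" for z
  proof (rule orbit_cong)
    show "z \<in> orbit q z"
      by (rule orbit_permutes_atLeastAtMost[OF q])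
    fix s assume s: "s \<in> orbit q z"
    have "s \<noteq> ?y"
      using s orbit_permutes_atLeastAtMost(3)[OF q z(1)] by auto
    moreover have "s \<noteq> x"
      using s z(2) orbit_swap orbit_permutes_atLeastAtMost(1)[OF q] by metis
    ultimately show "?q s = q s"
      by (simp add: transpose_def)
  qed
  have new: "orbit ?q z = insert ?y ?O" if "z \<in> insert ?y ?O" for z
    using orbit_cyclic_eq3[OF cyc that] .
  have same: "orbit q z = ?O" if "z \<in> ?O" for z
    using that orbit_permutes_atLeastAtMost(2)[OF q] orbit_cyclic_eq3 by metis
  have "orbit ?q ` {1..Suc n} = insert (insert ?y ?O) (?A - {?O})" (is "_ = ?R")
  proof (intro equalityI subsetI)
    fix C assume "C \<in> orbit ?q ` {1..Suc n}"
    then obtain z where z: "z \<in> {1..Suc n}" "C = orbit ?q z"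
      by auto
    show "C \<in> ?R"
    proof (cases "z \<in> insert ?y ?O")
      case False
      then have "z \<in> {1..n}" "z \<notin> ?O" "orbit q z \<noteq> ?O"
        using z orbit_permutes_atLeastAtMost(1)[OF q, of z] by auto
      then show ?thesis
        using old z by auto
    qed (use new z in auto)
  next
    fix C assume C: "C \<in> ?R"
    show "C \<in> orbit ?q ` {1..Suc n}"
    proof (cases "C = insert ?y ?O")
      case True
      then show ?thesis
        using new[of ?y] by (metis atLeastAtMost_iff imageI insertI1 le_add1 order_refl plus_1_eq_Suc)
    next
      case False
      then obtain z where z: "z \<in> {1..n}" "C = orbit q z" "C \<noteq> ?O"
        using C by blast
      then have "C = orbit ?q z"
        using old same by metis
      then show ?thesis
        using z by auto
    qed
  qed
  \<comment> \<open>Old orbits stay inside \<open>{1..n}\<close>, so the enlarged one is counted as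
    a separate element of the set of orbits.\<close>
  moreover have "insert ?y ?O \<notin> ?A"
    using orbit_permutes_atLeastAtMost(3)[OF q] by fastforce
  moreover have "card (insert ?y ?O) = Suc (card ?O)"
    using O by (subst card_insert_disjoint) auto
  moreover have "mset_set ?A = add_mset ?O (mset_set (?A - {?O}))"
    using mset_set.remove[of ?A ?O] x by auto
  ultimately show ?thesis
    by (simp add: cycle_type_def)
qed

lemma cycle_type_conj:
  assumes q: "q permutes {1..n}" and t: "t permutes {1..n}" and inv: "t \<circ> t = id"
  shows "cycle_type n (t \<circ> q \<circ> t) = cycle_type n q"
proof -
  have tt: "t (t z) = z" for z
    using inv by (metis comp_apply id_apply)
  have "orbit (t \<circ> q \<circ> t) (t z) = t ` orbit q z" for z
    using orbit_inverse[of z q "t \<circ> q \<circ> t" t] orbit_permutes_atLeastAtMost(1)[OF q]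
    by (simp add: tt)
  then have "orbit (t \<circ> q \<circ> t) ` t ` {1..n} = (`) t ` orbit q ` {1..n}"
    by (simp add: image_image)
  then have *: "orbit (t \<circ> q \<circ> t) ` {1..n} = (`) t ` orbit q ` {1..n}"
    using permutes_image[OF t] by simp
  have "inj t"
    using t permutes_inj by blast
  then have "inj_on ((`) t) (orbit q ` {1..n})" "\<And>A. card (t ` A) = card A"
    by (auto simp: inj_on_def inj_image_eq_iff card_image inj_def)
  then show ?thesis
    unfolding cycle_type_def * by (simp add: image_mset_mset_set[symmetric] multiset.map_comp comp_def)
qed

lemma cycle_type_Suc_fixed:
  assumes q: "q permutes {1..n}"
  shows "cycle_type (Suc n) q = add_mset 1 (cycle_type n q)"
proof -
  have "q (Suc n) = Suc n"
    using q by (simp add: permutes_def)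
  then have "orbit q (Suc n) = {Suc n}"
    by (simp add: orbit_eq_singleton_iff)
  moreover have "{Suc n} \<notin> orbit q ` {1..n}"
    using orbit_permutes_atLeastAtMost(3)[OF q] by fastforce
  ultimately show ?thesis
    by (simp add: cycle_type_def atLeastAtMostSuc_conv)
qed

section \<open>Factorisation through an involution and a full cycle\<close>

lemma sum_mset_ge_size:
  fixes \<mu> :: "nat multiset"
  assumes "0 \<notin># \<mu>"
  shows "size \<mu> \<le> sum_mset \<mu>"
  using assms by (induction \<mu>) auto

lemma sum_mset_ge_twice_size:
  fixes \<mu> :: "nat multiset"
  assumes "0 \<notin># \<mu>" and "1 \<notin># \<mu>"
  shows "2 * size \<mu> \<le> sum_mset \<mu>"
  using assms by (induction \<mu>) auto

lemma sum_mset_eq_size: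
  fixes \<mu> :: "nat multiset"
  assumes "\<And>m. m \<in># \<mu> \<Longrightarrow> m = 1"
  shows "sum_mset \<mu> = size \<mu>"
  using assms by (induction \<mu>) auto

text \<open>The numerical hypothesis is the genus 0 Riemann-Hurwitz relation for \<open>r\<close>,
  \<open>c\<close> and \<open>r \<circ> c\<close>, with \<open>c\<close> a full cycle.\<close>

lemma exists_involution_times_cycle:
  assumes "\<mu> \<noteq> {#}" and "0 \<notin># \<mu>" and "sum_mset \<mu> = n" and "n + 2 = 2 * size \<mu> + f"
  shows "\<exists>r c. r permutes {1..n} \<and> r \<circ> r = id \<and> c permutes {1..n} \<and> cyclic_on c {1..n} \<and>
    card {x \<in> {1..n}. r x = x} = f \<and> cycle_type n (r \<circ> c) = \<mu>"
  using assms
proof (induction n arbitrary: \<mu> f)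
  case 0
  \<comment> \<open>This case is vacuous, since a nonempty multiset of positive parts has positive
    sum. The true base case is \<open>n = 1\<close>, reached below when all parts are 1.\<close>
  then show ?case
    using sum_mset_ge_size[of \<mu>] by auto
next
  case (Suc n)
  let ?y = "Suc n"
  have grow_perm: "p permutes {1..Suc n}" if "p permutes {1..n}" for p :: "nat \<Rightarrow> nat"
    using that by (rule permutes_subset) auto
  have fresh: "p ?y = ?y" if "p permutes {1..n}" for p :: "nat \<Rightarrow> nat"
    using that by (simp add: permutes_def)
  have cyc: "cyclic_on (c \<circ> transpose x ?y) {1..Suc n}"
    if "c permutes {1..n}" "cyclic_on c {1..n}" "x \<in> {1..n}" for c x
    using cyclic_on_insert[OF that(2,3), of ?y] fresh[OF that(1)]
    by (simp add: atLeastAtMostSuc_conv)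
  have transp: "transpose x ?y permutes {1..Suc n}" if "x \<in> {1..n}" for x
    using that by (intro permutes_swap_id) auto
  show ?case
  proof (cases "f = 0")
    case True
    \<comment> \<open>With \<open>f = 0\<close> the sum of the parts is
      \<open>2 * size \<mu> - 2\<close>, so the parts cannot all be at least 2.\<close>
    have "1 \<in># \<mu>"
      using sum_mset_ge_twice_size[of \<mu>] Suc.prems True by auto
    then obtain \<nu> where \<nu>: "\<mu> = add_mset 1 \<nu>"
      by (metis multi_member_split)
    then have "\<nu> \<noteq> {#}"
      using Suc.prems True by auto
    \<comment> \<open>Dropping a part 1 raises the number of fixed points from 0 to 1; the unique
      fixed point is then paired with the new point.\<close>
    moreover have "0 \<notin># \<nu>" "sum_mset \<nu> = n" "n + 2 = 2 * size \<nu> + 1"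
      using Suc.prems True \<nu> by auto
    ultimately obtain r c where r: "r permutes {1..n}" "r \<circ> r = id"
      and c: "c permutes {1..n}" "cyclic_on c {1..n}"
      and f: "card {x \<in> {1..n}. r x = x} = 1" and ct: "cycle_type n (r \<circ> c) = \<nu>"
      using Suc.IH by blast
    obtain x where fx: "{x \<in> {1..n}. r x = x} = {x}"
      using f card_1_singletonE by blast
    then have x: "x \<in> {1..n}" "r x = x"
      by auto
    let ?t = "transpose x ?y"
    have rr: "r (r z) = z" for z
      using r(2) by (metis comp_apply id_apply)
    have q: "r \<circ> c permutes {1..n}"
      using permutes_compose[OF c(1) r(1)] .
    have r': "?t (r z) = (if z = x then ?y else if z = ?y then x else r z)" for z
      using x fresh[OF r(1)] rr by (metis transpose_apply_first transpose_apply_other transpose_apply_second)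
    have "?t \<circ> r permutes {1..Suc n}"
      using permutes_compose[OF grow_perm[OF r(1)] transp[OF x(1)]] .
    moreover have "(?t \<circ> r) \<circ> (?t \<circ> r) = id"
    proof
      fix z show "((?t \<circ> r) \<circ> (?t \<circ> r)) z = id z"
        using x fresh[OF r(1)] rr by (auto simp: r') (metis rr)+
    qed
    moreover have "c \<circ> ?t permutes {1..Suc n}"
      using permutes_compose[OF transp[OF x(1)] grow_perm[OF c(1)]] .
    moreover have "{z \<in> {1..Suc n}. (?t \<circ> r) z = z} = {}"
      using fx x by (auto simp: r' le_Suc_eq split: if_splits)
    then have "card {z \<in> {1..Suc n}. (?t \<circ> r) z = z} = f"
      using True by (simp only: card.empty)
    \<comment> \<open>The product is \<open>r \<circ> c\<close> conjugated by \<open>?t\<close>; on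
      the larger set \<open>r \<circ> c\<close> fixes the new point, which gives the part 1.\<close>
    moreover have "cycle_type (Suc n) ((?t \<circ> r) \<circ> (c \<circ> ?t)) = \<mu>"
      using cycle_type_conj[OF grow_perm[OF q] transp[OF x(1)]] cycle_type_Suc_fixed[OF q] ct \<nu>
      by (simp add: comp_assoc)
    ultimately show ?thesis
      using cyc[OF c x(1)] by blast
  next
    case False
    show ?thesis
    proof (cases "\<exists>m. m \<in># \<mu> \<and> m \<noteq> 1")
      case True
      then obtain m \<nu> where m: "\<mu> = add_mset m \<nu>" "m \<noteq> 1"
        by (auto dest: multi_member_split)
      then obtain l where "m = Suc l"
        using Suc.prems(2) by (cases m) auto
      then have \<nu>: "\<mu> = add_mset (Suc l) \<nu>" "l \<noteq> 0"
        using m by auto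
      \<comment> \<open>Shortening a part keeps the number of parts and lowers the sum by one, so
        \<open>f\<close> drops by one as well.\<close>
      have "0 \<notin># add_mset l \<nu>" "sum_mset (add_mset l \<nu>) = n"
        "n + 2 = 2 * size (add_mset l \<nu>) + (f - 1)"
        using Suc.prems \<nu> False by auto
      then obtain r c where r: "r permutes {1..n}" "r \<circ> r = id"
        and c: "c permutes {1..n}" "cyclic_on c {1..n}"
        and f: "card {x \<in> {1..n}. r x = x} = f - 1"
        and ct: "cycle_type n (r \<circ> c) = add_mset l \<nu>"
        using Suc.IH[OF add_mset_not_empty] by blast
      have q: "r \<circ> c permutes {1..n}"
        using permutes_compose[OF c(1) r(1)] .
      obtain x where x: "x \<in> {1..n}" "card (orbit (r \<circ> c) x) = l"
        using card_orbit_mem_cycle_type[of l n "r \<circ> c"] ct by auto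
      let ?t = "transpose x ?y"
      have "c \<circ> ?t permutes {1..Suc n}"
        using permutes_compose[OF transp[OF x(1)] grow_perm[OF c(1)]] .
      moreover have "{z \<in> {1..Suc n}. r z = z} = insert ?y {x \<in> {1..n}. r x = x}"
        using fresh[OF r(1)] by (auto simp: le_Suc_eq)
      then have "card {z \<in> {1..Suc n}. r z = z} = f"
        using f False by simp
      moreover have "cycle_type (Suc n) (r \<circ> (c \<circ> ?t)) = \<mu>"
        using cycle_type_enlarge[OF q x(1)] x(2) ct \<nu> by (simp add: comp_assoc)
      ultimately show ?thesis
        using cyc[OF c x(1)] grow_perm[OF r(1)] r(2) by blast
    next
      case ones: False
      then have "size \<mu> = Suc n"
        using sum_mset_eq_size[of \<mu>] Suc.prems by auto
      \<comment> \<open>With \<open>size \<mu> = Suc n\<close> the numerical hypothesis becomes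
        \<open>n + f = 1\<close>, while \<open>f\<close> is positive.\<close>
      then have "n = 0" "f = 1" "size \<mu> = 1"
        using Suc.prems False by auto
      then have "\<mu> = {#1#}"
        using Suc.prems ones
        by (metis One_nat_def size_1_singleton_mset union_single_eq_member add_mset_add_single)
      moreover have orb: "orbit id (1::nat) = {1}"
        by (simp only: orbit_eq_singleton_iff id_apply)
      moreover have one: "{1..Suc n} = {1}"
        using \<open>n = 0\<close> by simp
      ultimately have "cycle_type (Suc n) (id \<circ> id) = \<mu>" "cyclic_on id {1..Suc n}"
        by (simp_all only: cycle_type_def id_comp one cyclic_on_def image_insert image_empty)
          simp_all
      moreover have "card {x \<in> {1..Suc n}. id x = x} = f"
        using \<open>n = 0\<close> \<open>f = 1\<close> by simp
      ultimately have base: "id permutes {1..Suc n} \<and> id \<circ> id = id \<and> id permutes {1..Suc n} \<and>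
          cyclic_on id {1..Suc n} \<and> card {x \<in> {1..Suc n}. id x = x} = f \<and>
          cycle_type (Suc n) (id \<circ> id) = \<mu>"
        by (simp only: permutes_id id_comp simp_thms)
      show ?thesis
        by (rule exI[where x = id], rule exI[where x = id], rule base)
    qed
  qed
qed

section \<open>Numbering a full cycle along a path\<close>

text \<open>Exponents run from 1, not 0, to match the values of \<open>path_time\<close>; closing up
  at \<open>card S\<close> makes the two ranges equivalent.\<close>

lemma bij_betw_cyclic_funpow:
  assumes "cyclic_on c S" and "a \<in> S"
  shows "bij_betw (\<lambda>i. (c ^^ i) a) {1..card S} S" and "(c ^^ card S) a = a"
proof -
  let ?d = "funpow_dist1 c a a"
  have S: "S = orbit c a" and a: "a \<in> orbit c a"
    using assms orbit_cyclic_eq3 by metis+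
  have img: "S = (\<lambda>i. (c ^^ i) a) ` {0..<?d}"
    using orbit_conv_funpow_dist1[OF a] S by simp
  have d: "card S = ?d"
    using card_image[OF inj_on_funpow_dist1[OF a]] img by simp
  show fix_a: "(c ^^ card S) a = a"
    using funpow_dist1_prop[OF a] d by simp
  have "(\<lambda>i. (c ^^ i) a) ` {1..card S} = S"
  proof (intro equalityI subsetI)
    fix x assume "x \<in> S"
    then obtain i where i: "i < card S" "x = (c ^^ i) a"
      using img d by auto
    then show "x \<in> (\<lambda>i. (c ^^ i) a) ` {1..card S}"
      using fix_a by (cases "i = 0") (force intro: image_eqI[of _ _ "card S"])+
  qed (use cyclic_on_funpow_in[OF assms] in auto)
  then show "bij_betw (\<lambda>i. (c ^^ i) a) {1..card S} S"
    by (simp add: bij_betw_def eq_card_imp_inj_on)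
qed

text \<open>With the vertices of a path numbered \<open>0, \<dots>, n - 1\<close>, the Green involution is
  \<open>path_flip n True\<close> and the Blue one is \<open>path_flip n False\<close>. Truncated subtraction makes \<open>0\<close> a
  fixed point of the latter.\<close>

definition path_flip :: "nat \<Rightarrow> bool \<Rightarrow> nat \<Rightarrow> nat" where
  "path_flip n b j = (if even j = b then if Suc j < n then Suc j else j else j - 1)"

lemma path_flip_less: "j < n \<Longrightarrow> path_flip n b j < n"
  by (auto simp: path_flip_def)

lemma path_flip_flip: "j < n \<Longrightarrow> path_flip n b (path_flip n b j) = j"
  by (cases j) (auto simp: path_flip_def)

lemma path_flip_eq_self_iff:
  assumes "j < n"
  shows "path_flip n b j = j \<longleftrightarrow> j = 0 \<and> \<not> b \<or> j = n - 1 \<and> b = odd n"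
proof -
  obtain m where "n = Suc m"
    using assms by (cases n) auto
  then show ?thesis
    using assms by (cases j) (auto simp: path_flip_def less_Suc_eq)
qed

text \<open>The product of the two flips first runs up the odd positions and then down the even ones;
  \<open>path_time n j\<close> is the moment at which this walk, started at \<open>0\<close>, visits \<open>j\<close>.\<close>

definition path_time :: "nat \<Rightarrow> nat \<Rightarrow> nat" where
  "path_time n j = (if even j then n - j div 2 else Suc j div 2)"

text \<open>At the far end the fixed point of one flip turns the walk from odd to even positions; at
  \<open>0\<close> the fixed point of the Blue flip turns it back. Position \<open>0\<close> has
  time \<open>n\<close>, so the clock restarts at 1 there.\<close>

lemma path_time_step:
  assumes "j < n"
  shows "path_time n (path_flip n True (path_flip n False j)) =
    (if j = 0 then 1 else Suc (path_time n j))"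
proof (cases "even j")
  case True
  then obtain i where "j = 2 * i"
    by blast
  then show ?thesis
    using assms by (cases i) (auto simp: path_flip_def path_time_def)
next
  case False
  then obtain i where "j = 2 * i + 1"
    by (blast elim: oddE)
  then show ?thesis
    using assms by (auto simp: path_flip_def path_time_def)
qed

text \<open>Odd positions occupy the times up to \<open>n div 2\<close>, even positions the later
  ones. Injectivity and equal cardinalities give surjectivity.\<close>

lemma bij_betw_path_time: "bij_betw (path_time n) {..<n} {1..n}"
proof -
  have "inj_on (path_time n) {..<n}"
  proof (rule inj_onI)
    fix i j assume "i \<in> {..<n}" "j \<in> {..<n}" "path_time n i = path_time n j"
    moreover have "\<exists>k. i = 2 * k \<or> i = Suc (2 * k)" "\<exists>k. j = 2 * k \<or> j = Suc (2 * k)"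
      by presburger+
    ultimately show "i = j"
      by (auto simp: path_time_def)
  qed
  moreover have "path_time n ` {..<n} \<subseteq> {1..n}"
    by (auto simp: path_time_def elim: oddE)
  ultimately show ?thesis
    by (metis bij_betw_def card_atLeastAtMost card_image card_lessThan card_subset_eq diff_Suc_1
        finite_atLeastAtMost)
qed

text \<open>The product of the flips and \<open>c\<close> are both \<open>n\<close>-cycles; matching
  the walk with the powers of \<open>c\<close> applied to 1 intertwines them.\<close>

lemma cyclic_on_path_numbering:
  assumes "cyclic_on c {1..n}" and "n > 0"
  obtains \<sigma> where "bij_betw \<sigma> {..<n} {1..n}"
    and "\<And>j. j < n \<Longrightarrow> c (\<sigma> j) = \<sigma> (path_flip n True (path_flip n False j))"
proof
  let ?\<sigma> = "(\<lambda>i. (c ^^ i) 1) \<circ> path_time n"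
  note pow = bij_betw_cyclic_funpow[OF assms(1), of 1]
  show "bij_betw ?\<sigma> {..<n} {1..n}"
    using bij_betw_trans[OF bij_betw_path_time] pow(1) assms(2) by simp
  fix j assume "j < n"
  moreover have "c ((c ^^ n) 1) = c 1"
    using pow(2) assms(2) by simp
  ultimately show "c (?\<sigma> j) = ?\<sigma> (path_flip n True (path_flip n False j))"
    by (simp add: path_time_step) (simp add: path_time_def)
qed

section \<open>Moving permutations from positions to vertices\<close>

definition transport :: "nat \<Rightarrow> (nat \<Rightarrow> nat) \<Rightarrow> (nat \<Rightarrow> nat) \<Rightarrow> nat \<Rightarrow> nat" where
  "transport n \<sigma> h x = (if x \<in> {1..n} then \<sigma> (h (inv_into {..<n} \<sigma> x)) else x)"

lemma transport_apply:
  assumes "bij_betw \<sigma> {..<n} {1..n}" and "j < n"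
  shows "transport n \<sigma> h (\<sigma> j) = \<sigma> (h j)"
proof -
  have "\<sigma> j \<in> {1..n}" "inv_into {..<n} \<sigma> (\<sigma> j) = j"
    using assms by (auto simp: bij_betw_def inv_into_f_f)
  then show ?thesis
    by (simp add: transport_def)
qed

lemma transport_involution:
  assumes \<sigma>: "bij_betw \<sigma> {..<n} {1..n}"
    and h: "\<And>j. j < n \<Longrightarrow> h j < n" "\<And>j. j < n \<Longrightarrow> h (h j) = j"
  shows "transport n \<sigma> h permutes {1..n}" and "transport n \<sigma> h \<circ> transport n \<sigma> h = id"
proof -
  have out: "transport n \<sigma> h x = x" if "x \<notin> {1..n}" for x
    unfolding transport_def using that by (rule if_not_P)
  have tt: "transport n \<sigma> h (transport n \<sigma> h x) = x" for x
  proof (cases "x \<in> {1..n}")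
    case True
    then obtain j where "j < n" "x = \<sigma> j"
      using bij_betw_imp_surj_on[OF \<sigma>] by blast
    then show ?thesis
      using transport_apply[OF \<sigma>] h by simp
  qed (simp add: out)
  then show "transport n \<sigma> h \<circ> transport n \<sigma> h = id"
    by (simp add: fun_eq_iff)
  show "transport n \<sigma> h permutes {1..n}"
    unfolding permutes_def using out tt by metis
qed

section \<open>Groups generated by colours\<close>

lemma funpow_mem_colour_group:
  assumes "g \<in> colour_group n \<tau> C"
  shows "g ^^ i \<in> colour_group n \<tau> C"
proof (induction i)
  case 0
  show ?case
    using generate.one[of "sym_group n"] by (simp add: colour_group_def sym_group_one id_def)
next
  case (Suc i)
  then show ?case
    using assms generate.eng[of g "sym_group n" _ "g ^^ i"]
    unfolding colour_group_def sym_group_mult funpow.simps by blast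
qed

lemma colour_group_mono: "C \<subseteq> D \<Longrightarrow> colour_group n \<tau> C \<subseteq> colour_group n \<tau> D"
  unfolding colour_group_def by (intro group.mono_generate sym_group_is_group image_mono)

text \<open>The powers of a single full cycle in the group already reach every point.\<close>

lemma colour_group_transitive:
  assumes "cyclic_on g {1..n}" and "g \<in> colour_group n \<tau> C" and "x \<in> {1..n}" and "y \<in> {1..n}"
  shows "\<exists>h\<in>colour_group n \<tau> C. h x = y"
proof -
  have "y \<in> orbit g x"
    using assms orbit_cyclic_eq3 by metis
  then show ?thesis
    using funpow_mem_colour_group[OF assms(2)] by (auto simp: orbit_altdef)
qed

lemma colour_group_permutes:
  assumes "\<And>c. \<tau> c permutes {1..n}" and "g \<in> colour_group n \<tau> C"
  shows "g permutes {1..n}"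
proof -
  have "\<tau> ` C \<subseteq> carrier (sym_group n)"
    using assms(1) by (auto simp: sym_group_carrier)
  then show ?thesis
    using group.generate_in_carrier[OF sym_group_is_group] assms(2)
    unfolding colour_group_def sym_group_carrier[symmetric] by blast
qed

section \<open>The path-like surface of a full cycle\<close>

text \<open>Green and Blue are the two flips carried over by the numbering, and their product is
  \<open>c\<close>. The summand 2 counts the half-edges at the two ends of the path.\<close>

lemma path_like_surface_of_cycle:
  assumes r: "r permutes {1..n}" "r \<circ> r = id"
    and c: "c permutes {1..n}" "cyclic_on c {1..n}" and n: "n > 0"
  shows "\<exists>\<tau>. square_tiled_surface n \<tau> \<and> path_like n \<tau> \<and> \<tau> Red = r \<and> \<tau> Green \<circ> \<tau> Blue = c \<and>
    num_fixed_points n \<tau> = card {x \<in> {1..n}. r x = x} + 2"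
proof -
  obtain \<sigma> where \<sigma>: "bij_betw \<sigma> {..<n} {1..n}"
    and step: "\<And>j. j < n \<Longrightarrow> c (\<sigma> j) = \<sigma> (path_flip n True (path_flip n False j))"
    using cyclic_on_path_numbering[OF c(2) n] by blast
  define \<tau> where "\<tau> d = (if d = Red then r else transport n \<sigma> (path_flip n (d = Green)))" for d
  have inj: "\<sigma> i = \<sigma> j \<longleftrightarrow> i = j" if "i < n" "j < n" for i j
    using \<sigma> that by (auto simp: bij_betw_def inj_on_def)
  have range: "\<sigma> j \<in> {1..n}" if "j < n" for j
    using \<sigma> that by (auto simp: bij_betw_def)
  have surj: "\<exists>j<n. x = \<sigma> j" if "x \<in> {1..n}" for x
    using bij_betw_imp_surj_on[OF \<sigma>] that by blast
  have \<tau>_apply: "\<tau> d (\<sigma> j) = \<sigma> (path_flip n (d = Green) j)" if "d \<noteq> Red" "j < n" for d j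
    using transport_apply[OF \<sigma> that(2)] that(1) by (simp add: \<tau>_def)
  have \<tau>: "\<tau> d permutes {1..n}" "\<tau> d \<circ> \<tau> d = id" for d
    using r transport_involution[where h = "path_flip n (d = Green)",
        OF \<sigma> path_flip_less path_flip_flip]
    by (auto simp: \<tau>_def)
  have GB: "\<tau> Green \<circ> \<tau> Blue = c"
  proof
    fix x show "(\<tau> Green \<circ> \<tau> Blue) x = c x"
    proof (cases "x \<in> {1..n}")
      case True
      then show ?thesis
        using surj[OF True] by (auto simp: \<tau>_apply path_flip_less step)
    next
      case False
      then show ?thesis
        using \<tau>(1) c(1) by (simp add: permutes_def)
    qed
  qed
  have c_mem: "c \<in> colour_group n \<tau> {Green, Blue}"
    using generate.eng[OF generate.incl generate.incl, of "\<tau> Green" "\<tau> ` {Green, Blue}" "\<tau> Blue"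
        "sym_group n"] GB
    by (simp add: colour_group_def sym_group_mult)
  note trans = colour_group_transitive[OF c(2)]
  have surface: "square_tiled_surface n \<tau>"
    unfolding square_tiled_surface_def
    using \<tau> trans c_mem colour_group_mono[of "{Green, Blue}" "{Red, Green, Blue}" n \<tau>] by blast
  have comp: "{g x | g. g \<in> colour_group n \<tau> {Green, Blue}} = {1..n}" if x: "x \<in> {1..n}" for x
  proof (intro equalityI subsetI)
    fix y assume "y \<in> {g x | g. g \<in> colour_group n \<tau> {Green, Blue}}"
    then obtain g where g: "g \<in> colour_group n \<tau> {Green, Blue}" "y = g x"
      by blast
    show "y \<in> {1..n}"
      unfolding g(2) permutes_in_image[OF colour_group_permutes[OF \<tau>(1) g(1)]] by (rule x)
  next
    fix y assume "y \<in> {1..n}"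
    then obtain g where "g \<in> colour_group n \<tau> {Green, Blue}" "g x = y"
      using trans[OF c_mem x] by blast
    then show "y \<in> {g x | g. g \<in> colour_group n \<tau> {Green, Blue}}"
      by blast
  qed
  have "GB_components n \<tau> = (\<lambda>x. {g x | g. g \<in> colour_group n \<tau> {Green, Blue}}) ` {1..n}"
    unfolding GB_components_def by (rule Setcompr_eq_image)
  also have "\<dots> = (\<lambda>_. {1..n}) ` {1..n}"
    by (rule image_cong[OF refl comp])
  also have "\<dots> = {{1..n}}"
    using n by (simp add: image_constant_conv)
  finally have components: "GB_components n \<tau> = {{1..n}}" .
  define vs where "vs = map \<sigma> [0..<n]"
  \<comment> \<open>Entry 0 is the half-edge at \<open>\<sigma> 0\<close>, Blue because the Blue
    flip fixes \<open>0\<close>; entry \<open>Suc i\<close> is the edge from position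
    \<open>i\<close> to \<open>Suc i\<close>, Green for even \<open>i\<close>; entry
    \<open>n\<close> is the last half-edge.\<close>
  define cs where "cs = map (\<lambda>j. if even j then Blue else Green) [0..<Suc n]"
  have half: "{(d, x) \<in> dual_half_edges n \<tau>. d \<in> {Green, Blue} \<and> x \<in> {1..n}} =
      {(Blue, \<sigma> 0), (if even n then Blue else Green, \<sigma> (n - 1))}" (is "?L = ?R")
  proof (intro equalityI subsetI)
    fix p assume "p \<in> ?L"
    then obtain d x where p: "p = (d, x)" "x \<in> {1..n}" "\<tau> d x = x" "d \<noteq> Red"
      by (auto simp: dual_half_edges_def)
    moreover obtain j where j: "j < n" "x = \<sigma> j"
      using surj p by blast
    ultimately have "path_flip n (d = Green) j = j"
      using inj \<tau>_apply path_flip_less by metis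
    then have "j = 0 \<and> d \<noteq> Green \<or> j = n - 1 \<and> (d = Green) = odd n"
      using path_flip_eq_self_iff[OF j(1)] by simp
    then show "p \<in> ?R"
      using p(1,4) j(2) by (cases d) auto
  next
    fix p assume "p \<in> ?R"
    then show "p \<in> ?L"
      using n range[of 0] range[of "n - 1"] path_flip_eq_self_iff[of 0 n False]
        path_flip_eq_self_iff[of "n - 1" n "odd n"]
      by (auto simp: dual_half_edges_def \<tau>_apply)
  qed
  have edges: "{(d, e) \<in> dual_edges n \<tau>. d \<in> {Green, Blue} \<and> e \<subseteq> {1..n}} =
      {(cs ! Suc i, {vs ! i, vs ! Suc i}) | i. Suc i < length vs}" (is "?L = ?R")
  proof (intro equalityI subsetI)
    fix p assume "p \<in> ?L"
    then obtain d x where p: "p = (d, {x, \<tau> d x})" "x \<in> {1..n}" "\<tau> d x \<noteq> x" "d \<noteq> Red"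
      by (auto simp: dual_edges_def)
    obtain j where j: "j < n" "x = \<sigma> j"
      using surj p by blast
    let ?j = "path_flip n (d = Green) j"
    have p': "p = (d, {\<sigma> j, \<sigma> ?j})" "?j \<noteq> j"
      using p j \<tau>_apply by auto
    \<comment> \<open>The index \<open>i\<close> is the lower end of the edge: \<open>j\<close> if
      the flip goes up, \<open>j - 1\<close> otherwise.\<close>
    have "\<exists>i. Suc i < n \<and> {i, Suc i} = {j, ?j} \<and> (d = Green \<longleftrightarrow> even i)"
    proof (cases "?j = Suc j")
      case True
      then show ?thesis
        using j p'(2) by (intro exI[of _ j]) (auto simp: path_flip_def split: if_splits)
    next
      case False
      then show ?thesis
        using j p'(2) by (intro exI[of _ "j - 1"]) (auto simp: path_flip_def split: if_splits)
    qed
    then obtain i where i: "Suc i < n" "{i, Suc i} = {j, ?j}" "d = Green \<longleftrightarrow> even i"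
      by blast
    have "{\<sigma> j, \<sigma> ?j} = {\<sigma> i, \<sigma> (Suc i)}"
      using arg_cong[OF i(2), of "image \<sigma>"] by simp
    moreover have "cs ! Suc i = d"
      using i(1,3) p(4) by (cases d) (simp_all add: cs_def del: upt_Suc)
    ultimately have "p = (cs ! Suc i, {vs ! i, vs ! Suc i})"
      using p'(1) i(1) by (simp add: vs_def)
    then show "p \<in> ?R"
      using i(1) by (auto simp: vs_def)
  next
    fix p assume "p \<in> ?R"
    then obtain i where i: "Suc i < n" "p = (cs ! Suc i, {vs ! i, vs ! Suc i})"
      by (auto simp: vs_def)
    define d where "d = (if even i then Green else Blue)"
    have "p = (d, {\<sigma> i, \<sigma> (Suc i)})" "d \<noteq> Red"
      using i by (auto simp: d_def cs_def vs_def simp del: upt_Suc)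
    moreover have "\<tau> d (\<sigma> i) = \<sigma> (Suc i)"
      using i \<tau>_apply[of d i] by (auto simp: d_def path_flip_def)
    moreover have "\<sigma> (Suc i) \<noteq> \<sigma> i"
      using i inj by auto
    ultimately show "p \<in> ?L"
      using range[of i] range[of "Suc i"] i by (cases d) (auto simp: dual_edges_def)
  qed
  have "distinct vs" "set vs = {1..n}"
    using \<sigma> by (auto simp: vs_def distinct_map bij_betw_def atLeast0LessThan)
  moreover have "hd cs = Blue" "last cs = (if even n then Blue else Green)"
    "hd vs = \<sigma> 0" "last vs = \<sigma> (n - 1)" "vs \<noteq> []" "length cs = Suc (length vs)"
    using n by (auto simp: cs_def vs_def hd_map last_map hd_upt upt_rec[of 0] simp del: upt_Suc)
  ultimately have "is_path n \<tau> {1..n}"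
    unfolding is_path_def using edges half by (intro exI[of _ vs] exI[of _ cs]) simp
  then have "path_like n \<tau>"
    using components by (auto simp: path_like_def)
  moreover have "num_fixed_points n \<tau> = card {x \<in> {1..n}. r x = x} + 2"
  proof -
    have "{(d, x) \<in> dual_half_edges n \<tau>. d \<in> {Green, Blue} \<and> x \<in> {1..n}} =
      Pair Green ` {x \<in> {1..n}. \<tau> Green x = x} \<union> Pair Blue ` {x \<in> {1..n}. \<tau> Blue x = x}"
      by (auto simp: dual_half_edges_def)
    \<comment> \<open>For \<open>n = 1\<close> both half-edges sit at the same vertex but differ in
      colour; for larger \<open>n\<close> the vertices differ.\<close>
    moreover have "(Blue, \<sigma> 0) \<noteq> (if even n then Blue else Green, \<sigma> (n - 1))"
      using inj[of 0 "n - 1"] n by (cases n) auto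
    ultimately have "card (Pair Green ` {x \<in> {1..n}. \<tau> Green x = x} \<union>
        Pair Blue ` {x \<in> {1..n}. \<tau> Blue x = x}) = 2"
      using half unfolding card_2_iff by metis
    moreover have "card (Pair Green ` {x \<in> {1..n}. \<tau> Green x = x} \<union>
        Pair Blue ` {x \<in> {1..n}. \<tau> Blue x = x}) =
      card {x \<in> {1..n}. \<tau> Green x = x} + card {x \<in> {1..n}. \<tau> Blue x = x}"
      by (subst card_Un_disjoint) (auto simp: card_image inj_on_def)
    ultimately show ?thesis
      by (simp add: num_fixed_points_def \<tau>_def)
  qed
  ultimately show ?thesis
    using surface GB by (intro exI[of _ \<tau>]) (simp add: \<tau>_def)
qed

section \<open>The spherical condition and the conclusion\<close>

lemma spherical_iff:
  "spherical \<mu> k \<longleftrightarrow> sum_mset \<mu> + 4 = 2 * size \<mu> + k"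
proof -
  \<comment> \<open>The index set is a fixed finite superset of the support, because the support
    itself can change when a part is added in the induction.\<close>
  have "(\<Sum>i\<in>A. int (count \<mu> i) * (int i - 2)) = int (sum_mset \<mu>) - 2 * int (size \<mu>)"
    if "finite A" "set_mset \<mu> \<subseteq> A" for A
    using that(2)
  proof (induction \<mu>)
    case (add x \<mu>)
    have "(\<Sum>i\<in>A. int (count (add_mset x \<mu>) i) * (int i - 2)) =
        (\<Sum>i\<in>A. int (count \<mu> i) * (int i - 2) + (if i = x then int x - 2 else 0))"
      by (intro sum.cong) (auto simp: algebra_simps)
    then show ?case
      using add that(1) by (simp add: sum.distrib)
  qed simp
  then have "(\<Sum>i\<in>set_mset \<mu>. int (count \<mu> i) * (int i - 2)) =
      int (sum_mset \<mu>) - 2 * int (size \<mu>)"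
    by blast
  then show ?thesis
    unfolding spherical_def by linarith
qed

theorem theorem3p1:
  fixes \<mu> :: "nat multiset" and k :: nat
  assumes "\<mu> \<noteq> {#}" and "0 \<notin># \<mu>"
    and "spherical \<mu> k"
    and "k \<ge> 2"
  shows "\<exists>n \<tau>. square_tiled_surface n \<tau> \<and> path_like n \<tau> \<and> profile n \<tau> = (\<mu>, k)"
proof -
  \<comment> \<open>The size is forced: the cycle lengths of a permutation of \<open>{1..n}\<close>
    sum to \<open>n\<close>.\<close>
  define n where "n = sum_mset \<mu>"
  \<comment> \<open>Two of the \<open>k\<close> fixed points are reserved for the ends of the path;
    the subtraction is exact since \<open>k \<ge> 2\<close>.\<close>
  have eq: "n + 2 = 2 * size \<mu> + (k - 2)"
    using assms(3,4) by (simp add: spherical_iff n_def)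
  have "n > 0"
    using sum_mset_ge_size[OF assms(2)] assms(1) by (simp add: n_def nonempty_has_size)
  obtain r c where rc: "r permutes {1..n}" "r \<circ> r = id" "c permutes {1..n}" "cyclic_on c {1..n}"
    and f: "card {x \<in> {1..n}. r x = x} = k - 2" and ct: "cycle_type n (r \<circ> c) = \<mu>"
    using exists_involution_times_cycle[OF assms(1,2) n_def[symmetric] eq] by blast
  obtain \<tau> where "square_tiled_surface n \<tau>" "path_like n \<tau>"
    and \<tau>: "\<tau> Red = r" "\<tau> Green \<circ> \<tau> Blue = c"
      "num_fixed_points n \<tau> = card {x \<in> {1..n}. r x = x} + 2"
    using path_like_surface_of_cycle[OF rc \<open>n > 0\<close>] by blast
  moreover have "profile n \<tau> = (\<mu>, k)"
    using \<tau> f ct assms(4) by (simp add: profile_def comp_assoc)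
  ultimately show ?thesis
    by blast
qed

end
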